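(* For every integer $n\ge 11$, the graph $P(n,3)$ has an edge resolving set consisting of exactly $4$ vertices.
   Context: For integers $n\ge 3$ and $1\le k<n/2$, the generalized Petersen graph $P(n,k)$ is the graph with vertex set $\{u_j,v_j : j\in\mathbb{Z}_n\}$ and edge set $\{u_ju_{j+1},\,v_jv_{j+k},\,u_jv_j : j\in\mathbb{Z}_n\}$, indices taken modulo $n$. In a connected graph $G$, the distance between a vertex $x$ and an edge $e=yz$ is $d(x,e)=\min\{d(x,y),d(x,z)\}$, where $d(\cdot,\cdot)$ is the usual graph distance. A set $R$ of vertices is an edge resolving set of $G$ if for every two distinct edges $e,e'$ of $G$ there is $x\in R$ with $d(x,e)\ne d(x,e')$. *)

theory Defs
  imports "Graph_Theory.Graph_Theory"
begin

text \<open>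
  Following \<^theory>\<open>Graph_Theory.Digraph\<close>, an undirected graph is a symmetric digraph
  (locale \<^locale>\<open>graph\<close>).  An undirected edge is the unordered pair of ends of an arc, so that
  an arc and its reversal give the same edge.
\<close>

definition uedges :: "('a, 'b) pre_digraph \<Rightarrow> 'a set set" where
  "uedges G = {{tail G a, head G a} | a. a \<in> arcs G}"

text \<open>
  The usual graph distance is the least cost of a walk when all arcs have cost 1.  It takes
  values in \<^typ>\<open>ereal\<close>, and is finite between any two vertices of a connected graph.
\<close>

definition graph_dist :: "('a, 'b) pre_digraph \<Rightarrow> 'a \<Rightarrow> 'a \<Rightarrow> ereal" where
  "graph_dist G x y = wf_digraph.\<mu> G (\<lambda>_. 1) x y"

lemma graph_dist_eq_INF_length:
  assumes "wf_digraph G"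
  shows "graph_dist G x y = (INF p \<in> {p. pre_digraph.awalk G x p y}. ereal (real (length p)))"
proof -
  interpret wf_digraph G by (rule assms)
  have "awalk_cost (\<lambda>_. 1) p = real (length p)" for p :: "'b list"
    by (induction p) simp_all
  then show ?thesis
    by (simp add: graph_dist_def \<mu>_def)
qed

definition vertex_edge_dist :: "('a, 'b) pre_digraph \<Rightarrow> 'a \<Rightarrow> 'a set \<Rightarrow> ereal" where
  "vertex_edge_dist G x e = Min (graph_dist G x ` e)"

lemma vertex_edge_dist_doubleton:
  "vertex_edge_dist G x {y, z} = min (graph_dist G x y) (graph_dist G x z)"
  by (simp add: vertex_edge_dist_def)

definition edge_resolving_set :: "('a, 'b) pre_digraph \<Rightarrow> 'a set \<Rightarrow> bool" where
  "edge_resolving_set G R \<longleftrightarrow> R \<subseteq> verts G \<and>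
     (\<forall>e \<in> uedges G. \<forall>e' \<in> uedges G. e \<noteq> e' \<longrightarrow>
       (\<exists>x \<in> R. vertex_edge_dist G x e \<noteq> vertex_edge_dist G x e'))"

text \<open>
  The generalized Petersen graph; the residues modulo \<open>n\<close> are represented by \<open>0, \<dots>, n - 1\<close>.
  The definition is meant for \<open>n \<ge> 3\<close> and \<open>1 \<le> k < n/2\<close> only.
\<close>

datatype petersen_vertex = U nat | V nat

definition petersen_arcs :: "nat \<Rightarrow> nat \<Rightarrow> (petersen_vertex \<times> petersen_vertex) set" where
  "petersen_arcs n k =
     {(U j, U ((j + 1) mod n)) | j. j < n} \<union>
     {(V j, V ((j + k) mod n)) | j. j < n} \<union>
     {(U j, V j) | j. j < n}"

definition petersen ::
  "nat \<Rightarrow> nat \<Rightarrow> (petersen_vertex, petersen_vertex \<times> petersen_vertex) pre_digraph" where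
  "petersen n k = with_proj
     \<lparr> pverts = U ` {..<n} \<union> V ` {..<n},
       parcs = petersen_arcs n k \<union> (petersen_arcs n k)\<inverse> \<rparr>"

lemma uedges_petersen:
  "uedges (petersen n k) =
     {{U j, U ((j + 1) mod n)} | j. j < n} \<union>
     {{V j, V ((j + k) mod n)} | j. j < n} \<union>
     {{U j, V j} | j. j < n}"
  (is "?L = ?R")
proof
  show "?L \<subseteq> ?R"
    unfolding uedges_def petersen_def petersen_arcs_def
    by (auto simp: insert_commute)
  show "?R \<subseteq> ?L"
    unfolding uedges_def petersen_def petersen_arcs_def
    by (auto simp: insert_commute) force+
qed

lemma mod_add_neq_self:
  fixes j n k :: nat
  assumes "j < n" "0 < k" "k < n"
  shows "(j + k) mod n \<noteq> j"
  using assms by (cases "j + k < n") (auto simp: mod_if)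

lemma graph_petersen:
  assumes "n \<ge> 3" "1 \<le> k" "2 * k < n"
  shows "graph (petersen n k)"
proof -
  let ?G = "\<lparr> pverts = U ` {..<n} \<union> V ` {..<n},
              parcs = petersen_arcs n k \<union> (petersen_arcs n k)\<inverse> \<rparr>"
  have sub: "petersen_arcs n k \<subseteq> pverts ?G \<times> pverts ?G"
    using assms by (auto simp: petersen_arcs_def)
  have fin: "finite (petersen_arcs n k)"
    by (rule finite_subset[OF sub]) simp
  have loopfree: "(a, a) \<notin> petersen_arcs n k" for a
    using assms mod_add_neq_self[of _ n 1] mod_add_neq_self[of _ n k]
    by (auto simp: petersen_arcs_def dest: sym)
  interpret pair_graph ?G
    using sub fin loopfree
    by unfold_locales (auto simp: symmetric_def sym_def)
  show ?thesis
    unfolding petersen_def by (rule graph_axioms)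
qed

lemma connected_petersen:
  assumes "n \<ge> 3" "1 \<le> k" "2 * k < n"
  shows "connected (petersen n k)"
proof -
  let ?G = "petersen n k"
  interpret G: graph ?G by (rule graph_petersen[OF assms])
  have dom: "x \<rightarrow>\<^bsub>?G\<^esub> y" if "(x, y) \<in> petersen_arcs n k" for x y
    using that by (simp add: petersen_def)
  have U0: "U 0 \<rightarrow>\<^sup>*\<^bsub>?G\<^esub> U j" if "j < n" for j
    using that
  proof (induction j)
    case 0
    then have "U 0 \<in> verts ?G" by (simp add: petersen_def)
    then show ?case by (rule G.reachable_refl)
  next
    case (Suc j)
    have "(U j, U (Suc j)) \<in> petersen_arcs n k"
      using Suc.prems unfolding petersen_arcs_def by force
    then show ?case
      using Suc G.reachable_adj_trans[OF _ dom] by simp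
  qed
  have V0: "U 0 \<rightarrow>\<^sup>*\<^bsub>?G\<^esub> V j" if "j < n" for j
    using G.reachable_adj_trans[OF U0[OF that] dom] that by (simp add: petersen_arcs_def)
  have from0: "U 0 \<rightarrow>\<^sup>*\<^bsub>?G\<^esub> x" if "x \<in> verts ?G" for x
    using that U0 V0 by (auto simp: petersen_def)
  show ?thesis
  proof (rule G.connectedI)
    show "verts ?G \<noteq> {}"
      using assms by (auto simp: petersen_def)
    show "x \<rightarrow>\<^sup>*\<^bsub>mk_symmetric ?G\<^esub> y" if "x \<in> verts ?G" "y \<in> verts ?G" for x y
      by (rule G.reachable_mk_symmetricI)
        (rule G.reachable_trans[OF G.symmetric_reachable'[OF from0[OF that(1)]] from0[OF that(2)]])
  qed
qed

end

theory Submission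
  imports Defs
begin

text \<open>
  The resolving set is \<open>U 0\<close>, \<open>V 1\<close>, \<open>V 2\<close>, \<open>U p\<close>, where \<open>p = n div 2 - 2\<close> (but \<open>p = 11\<close> for \<open>n = 14\<close>).
  The graph \<open>P(n,3)\<close> is the quotient by \<open>n\<close> of an infinite graph over the integers, whose distances
  have a closed form that grows by 1 with every step of length 3; distances in \<open>P(n,3)\<close> are minima
  over the lifts.  Call the four distances to an edge its code.  Replace \<open>n\<close> by \<open>n + 6\<close> and \<open>p\<close> by
  \<open>p + 3\<close>, which inserts three positions into each of the two arcs between \<open>0\<close> and \<open>p\<close>.  Edges near \<open>0\<close> keep
  their first three distances and gain 1 in the last; the edges away from \<open>0\<close>, moved along by three
  positions, gain 1 in the first three and keep the last.  The distance to \<open>U 0\<close> alone tells which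
  of the two descriptions applies, so if the codes for \<open>n\<close> are distinct, then so are those for \<open>n + 6\<close>,
  provided that \<open>n \<ge> 48\<close>.  The cases \<open>n < 54\<close> are evaluated.
\<close>

section \<open>Recognising the graph distance from local conditions\<close>

text \<open>The bound along arcs makes \<open>f y\<close> at most the length of any walk from
  \<open>x\<close> to \<open>y\<close>. Descending through predecessors ends at the only zero
  \<open>x\<close> and yields a walk of length at most \<open>f y\<close>.\<close>

lemma graph_dist_eqI:
  fixes f :: "'a \<Rightarrow> nat"
  assumes "wf_digraph G" "x \<in> verts G" "f x = 0"
    and zero: "\<And>y. y \<in> verts G \<Longrightarrow> f y = 0 \<Longrightarrow> y = x"
    and lip: "\<And>a. a \<in> arcs G \<Longrightarrow> f (head G a) \<le> f (tail G a) + 1"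
    and desc: "\<And>y. y \<in> verts G \<Longrightarrow> f y \<noteq> 0 \<Longrightarrow> \<exists>a\<in>arcs G. head G a = y \<and> f (tail G a) < f y"
    and "y \<in> verts G"
  shows "graph_dist G x y = ereal (real (f y))"
proof -
  interpret wf_digraph G by fact
  have lower: "f v \<le> f u + length q" if "awalk u q v" for u v q
    using that
  proof (induction q arbitrary: u)
    case (Cons a q)
    then show ?case using lip[of a] by (fastforce simp: awalk_Cons_iff)
  qed (auto simp: awalk_Nil_iff)
  have upper: "\<exists>q. awalk x q v \<and> length q \<le> f v" if "v \<in> verts G" for v
    using that
  proof (induction "f v" arbitrary: v rule: less_induct)
    case less
    show ?case
    proof (cases "f v = 0")
      case True
      then show ?thesis using zero[OF less.prems] less.prems by (auto intro!: exI[of _ "[]"] simp: awalk_Nil_iff)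
    next
      case False
      then obtain a where a: "a \<in> arcs G" "head G a = v" "f (tail G a) < f v"
        using desc[OF less.prems] by blast
      then obtain q where "awalk x q (tail G a)" "length q \<le> f (tail G a)"
        using less.hyps by (meson tail_in_verts)
      then have "awalk x (q @ [a]) v" "length (q @ [a]) \<le> f v"
        using a arc_implies_awalk[OF a(1)] by (auto intro: awalk_appendI)
      then show ?thesis by blast
    qed
  qed
  obtain q where q: "awalk x q y" "length q \<le> f y"
    using upper[OF \<open>y \<in> verts G\<close>] by blast
  show ?thesis
    unfolding graph_dist_eq_INF_length[OF \<open>wf_digraph G\<close>]
  proof (rule antisym)
    show "(INF p\<in>{p. awalk x p y}. ereal (real (length p))) \<le> ereal (real (f y))"
      by (rule INF_lower2[of q]) (use q in auto)
    show "ereal (real (f y)) \<le> (INF p\<in>{p. awalk x p y}. ereal (real (length p)))"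
      by (rule INF_greatest) (use lower \<open>f x = 0\<close> in force)
  qed
qed

section \<open>Distances in the infinite graph\<close>

text \<open>
  The distance between two vertices of the infinite graph at positions that differ by \<open>z\<close>; the flags
  say whether the vertices are of the form \<open>V\<close>.
\<close>

definition cover_dist :: "bool \<Rightarrow> bool \<Rightarrow> int \<Rightarrow> nat" where
  "cover_dist s t z = nat (
     if s \<and> t then \<bar>z\<bar> div 3 + (if \<bar>z\<bar> mod 3 = 0 then 0 else \<bar>z\<bar> mod 3 + 2)
     else if s \<or> t then \<bar>z\<bar> div 3 + \<bar>z\<bar> mod 3 + 1
     else if \<bar>z\<bar> < 3 then \<bar>z\<bar> else \<bar>z\<bar> div 3 + \<bar>z\<bar> mod 3 + 2)"


text \<open>Makes statements about \<^const>\<open>cover_dist\<close> free of \<open>div\<close> and \<open>mod\<close>, for linear arithmetic.\<close>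

lemma cover_dist_cases:
  obtains (0) q where "\<bar>z\<bar> = 3 * int q"
      "cover_dist s t z = (if s \<and> t then q else if s \<or> t then q + 1 else if q = 0 then 0 else q + 2)"
    | (1) q where "\<bar>z\<bar> = 3 * int q + 1"
      "cover_dist s t z = (if s \<and> t then q + 3 else if s \<or> t then q + 2 else if q = 0 then 1 else q + 3)"
    | (2) q where "\<bar>z\<bar> = 3 * int q + 2"
      "cover_dist s t z = (if s \<and> t then q + 4 else if s \<or> t then q + 3 else if q = 0 then 2 else q + 4)"
proof -
  define q where "q = nat (\<bar>z\<bar> div 3)"
  consider "\<bar>z\<bar> = 3 * int q" | "\<bar>z\<bar> = 3 * int q + 1" | "\<bar>z\<bar> = 3 * int q + 2"
    unfolding q_def by linarith
  then show thesis
    by cases (rule that(1) that(2) that(3), assumption, simp add: cover_dist_def nat_add_distrib)+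
qed

lemma cover_dist_minus: "cover_dist s t (- z) = cover_dist s t z"
  by (simp add: cover_dist_def)

lemma cover_dist_eq_0_iff: "cover_dist s t z = 0 \<longleftrightarrow> s = t \<and> z = 0"
  by (cases rule: cover_dist_cases[of z s t]; auto)

lemma cover_dist_add_1_le: "cover_dist s False (z + 1) \<le> cover_dist s False z + 1"
  by (cases rule: cover_dist_cases[of z s False]; cases rule: cover_dist_cases[of "z + 1" s False];
      simp split: if_splits; arith)

lemma cover_dist_le_add_1: "cover_dist s False z \<le> cover_dist s False (z + 1) + 1"
  by (cases rule: cover_dist_cases[of z s False]; cases rule: cover_dist_cases[of "z + 1" s False];
      simp split: if_splits; arith)

lemma cover_dist_add_3_le: "cover_dist s True (z + 3) \<le> cover_dist s True z + 1"
  by (cases rule: cover_dist_cases[of z s True]; cases rule: cover_dist_cases[of "z + 3" s True];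
      simp split: if_splits; arith)

lemma cover_dist_le_add_3: "cover_dist s True z \<le> cover_dist s True (z + 3) + 1"
  by (cases rule: cover_dist_cases[of z s True]; cases rule: cover_dist_cases[of "z + 3" s True];
      simp split: if_splits; arith)

lemma cover_dist_spoke: "cover_dist s t z \<le> cover_dist s (\<not> t) z + 1"
  by (cases rule: cover_dist_cases[of z s t]; cases rule: cover_dist_cases[of z s "\<not> t"];
      simp split: if_splits; arith)

text \<open>Three more positions cost one more inner step. Two outer vertices less than 3 apart are
  joined along outer edges instead, hence the restriction.\<close>

lemma cover_dist_shift: "0 \<le> z \<Longrightarrow> s \<or> t \<or> 3 \<le> z \<Longrightarrow> cover_dist s t (z + 3) = cover_dist s t z + 1"
  by (cases rule: cover_dist_cases[of z s t]; cases rule: cover_dist_cases[of "z + 3" s t];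
      cases s; cases t; simp split: if_splits; arith)

text \<open>Remainders modulo 3 cost extra, so \<open>cover_dist\<close> is not monotone in the size
  of the offset. The margin 8 is sharp: between inner vertices the offset 3q + 2 costs q + 4, but 3q
  + 9 only q + 3.\<close>

lemma cover_dist_mono:  "\<bar>z\<bar> + 8 \<le> \<bar>w\<bar> \<Longrightarrow> cover_dist s t z \<le> cover_dist s t w"
  by (cases rule: cover_dist_cases[of z s t]; cases rule: cover_dist_cases[of w s t];
      simp split: if_splits; arith)



lemma cover_dist_descent_outer:
  assumes "cover_dist s False z \<noteq> 0"
  shows "cover_dist s False (z + 1) < cover_dist s False z \<or> cover_dist s False (z - 1) < cover_dist s False z
    \<or> cover_dist s True z < cover_dist s False z"
\<comment> \<open>The condition under which a shortest walk can arrive by the spoke. Otherwise it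
  arrives by an outer edge from the side of 0.\<close>
proof (cases "if s then \<bar>z\<bar> mod 3 = 0 else 3 \<le> \<bar>z\<bar>")
  case True
  then have "cover_dist s True z < cover_dist s False z"
    by (cases rule: cover_dist_cases[of z s False]; cases rule: cover_dist_cases[of z s True];
        simp split: if_splits; arith)
  then show ?thesis by blast
next
  case False
  have "z \<noteq> 0"
    using assms False by (auto simp: cover_dist_eq_0_iff split: if_splits)
  then have "cover_dist s False (if 0 < z then z - 1 else z + 1) < cover_dist s False z"
    using False
    by (cases rule: cover_dist_cases[of z s False];
        cases rule: cover_dist_cases[of "if 0 < z then z - 1 else z + 1" s False];
        simp split: if_splits; arith)
  then show ?thesis by (auto split: if_splits)
qed

lemma cover_dist_descent_inner:
  assumes "cover_dist s True z \<noteq> 0"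
  shows "cover_dist s True (z + 3) < cover_dist s True z \<or> cover_dist s True (z - 3) < cover_dist s True z
    \<or> cover_dist s False z < cover_dist s True z"
\<comment> \<open>Far out a shortest walk can arrive by an inner edge from the side of 0, close to 0
  by the spoke.\<close>
proof (cases "3 \<le> \<bar>z\<bar>")
  case True
  then have "cover_dist s True (if 0 < z then z - 3 else z + 3) < cover_dist s True z"
    by (cases rule: cover_dist_cases[of z s True];
        cases rule: cover_dist_cases[of "if 0 < z then z - 3 else z + 3" s True];
        simp split: if_splits; arith)
  then show ?thesis by (auto split: if_splits)
next
  case False
  moreover have "\<not> (s \<and> z = 0)"
    using assms by (simp add: cover_dist_eq_0_iff)
  ultimately have "cover_dist s False z < cover_dist s True z"
    by (cases rule: cover_dist_cases[of z s False]; cases rule: cover_dist_cases[of z s True];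
        simp split: if_splits; arith)
  then show ?thesis by blast
qed

subsection \<open>Distances in \<open>P(n,3)\<close>\<close>

text \<open>The infimum runs over all lifts of a residue. In this form periodicity, symmetry and the
  bounds along edges carry over from \<open>cover_dist\<close>; \<open>cyc_dist_eq_min\<close> is
  the form for computation.\<close>

definition cyc_dist :: "nat \<Rightarrow> bool \<Rightarrow> bool \<Rightarrow> int \<Rightarrow> nat" where
  "cyc_dist n s t z = (INF i. cover_dist s t (z + i * int n))"

lemma cyc_dist_le: "cyc_dist n s t z \<le> cover_dist s t (z + i * int n)"
  unfolding cyc_dist_def by (rule cINF_lower) auto

lemma cyc_dist_attained: obtains i where "cyc_dist n s t z = cover_dist s t (z + i * int n)"
proof -
  have "cyc_dist n s t z \<in> range (\<lambda>i. cover_dist s t (z + i * int n))"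
    unfolding cyc_dist_def by (rule Inf_nat_def1) simp
  then show thesis using that by auto
qed

lemma cyc_dist_lipschitz:
  assumes "\<And>w. cover_dist s t (w + d) \<le> cover_dist s t' w + 1"
  shows "cyc_dist n s t (z + d) \<le> cyc_dist n s t' z + 1"
proof -
  obtain i where i: "cyc_dist n s t' z = cover_dist s t' (z + i * int n)" by (rule cyc_dist_attained)
  have "cyc_dist n s t (z + d) \<le> cover_dist s t (z + i * int n + d)"
    using cyc_dist_le[of n s t "z + d" i] by (simp add: algebra_simps)
  also have "\<dots> \<le> cyc_dist n s t' z + 1" using assms i by simp
  finally show ?thesis .
qed

lemma cyc_dist_cong:
  assumes "int n dvd z - w"
  shows "cyc_dist n s t z = cyc_dist n s t w"
proof -
  have "cyc_dist n s t (x + k * int n) \<le> cyc_dist n s t x" for x k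
  proof -
    obtain i where "cyc_dist n s t x = cover_dist s t (x + i * int n)" by (rule cyc_dist_attained)
    then show ?thesis
      using cyc_dist_le[of n s t "x + k * int n" "i - k"] by (simp add: algebra_simps)
  qed
  note le = this
  obtain k where "z = w + k * int n"
    using assms by (auto simp: dvd_def algebra_simps)
  then show ?thesis
    using le[of w k] le[of z "- k"] by (simp add: antisym)
qed

lemma cyc_dist_minus: "cyc_dist n s t (- z) = cyc_dist n s t z"
proof -
  have "cyc_dist n s t (- x) \<le> cyc_dist n s t x" for x
  proof -
    obtain i where "cyc_dist n s t x = cover_dist s t (x + i * int n)" by (rule cyc_dist_attained)
    then show ?thesis
      using cyc_dist_le[of n s t "- x" "- i"] cover_dist_minus[of s t "x + i * int n"]
      by (simp add: algebra_simps)
  qed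
  from this[of z] this[of "- z"] show ?thesis by simp
qed

text \<open>Every lift other than \<open>z\<close> and \<open>z - n\<close> is farther from 0 than
  one of these two by at least \<open>n\<close>, which is at least the margin 8 of
  \<open>cover_dist_mono\<close>.\<close>

lemma cyc_dist_eq_min:
  assumes "8 \<le> n" "0 \<le> z" "z \<le> int n"
  shows "cyc_dist n s t z = min (cover_dist s t z) (cover_dist s t (int n - z))"
proof (rule antisym)
  show "cyc_dist n s t z \<le> min (cover_dist s t z) (cover_dist s t (int n - z))"
    using cyc_dist_le[of n s t z 0] cyc_dist_le[of n s t z "-1"] cover_dist_minus[of s t "z - int n"]
    by simp
  obtain i where i: "cyc_dist n s t z = cover_dist s t (z + i * int n)" by (rule cyc_dist_attained)
  consider "i = 0" | "i = -1" | "i \<ge> 1" | "i \<le> -2" by linarith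
  then show "min (cover_dist s t z) (cover_dist s t (int n - z)) \<le> cyc_dist n s t z"
  proof cases
    case 2
    then show ?thesis using i cover_dist_minus[of s t "z - int n"] by simp
  next
    case 3
    then have "int n \<le> i * int n" using mult_right_mono[of 1 i "int n"] by simp
    then have "cover_dist s t z \<le> cover_dist s t (z + i * int n)"
      using assms by (intro cover_dist_mono) linarith
    then show ?thesis using i by simp
  next
    case 4
    then have "i * int n \<le> -2 * int n" by (intro mult_right_mono) auto
    then have "cover_dist s t (int n - z) \<le> cover_dist s t (z + i * int n)"
      using assms by (intro cover_dist_mono) linarith
    then show ?thesis using i by simp
  qed (use i in simp)
qed

lemma cyc_dist_eq_cover_dist:
  assumes "2 * \<bar>z\<bar> + 8 \<le> int n"
  shows "cyc_dist n s t z = cover_dist s t z"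
proof -
  have "cyc_dist n s t \<bar>z\<bar> = cover_dist s t \<bar>z\<bar>"
    using assms cyc_dist_eq_min[of n "\<bar>z\<bar>" s t] cover_dist_mono[of "\<bar>z\<bar>" "int n - \<bar>z\<bar>" s t] by simp
  then show ?thesis
    using cyc_dist_minus[of n s t z] cover_dist_minus[of s t z] by (simp add: abs_if split: if_splits)
qed

text \<open>Both ways round the cycle, \<open>z\<close> and \<open>n - z\<close>, become longer by
  3. As both are at least 3, both terms of the minimum gain 1.\<close>

lemma cyc_dist_shift:
  assumes "8 \<le> n" "3 \<le> z" "z + 3 \<le> int n"
  shows "cyc_dist (n + 6) s t (z + 3) = cyc_dist n s t z + 1"
  using assms cover_dist_shift[of z s t] cover_dist_shift[of "int n - z" s t]
  by (simp add: cyc_dist_eq_min algebra_simps min_def)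

lemma cyc_dist_eq_0_iff: "cyc_dist n s t z = 0 \<longleftrightarrow> s = t \<and> int n dvd z"
proof
  assume *: "cyc_dist n s t z = 0"
  obtain i where "cyc_dist n s t z = cover_dist s t (z + i * int n)" by (rule cyc_dist_attained)
  then have "s = t \<and> z + i * int n = 0"
    using * cover_dist_eq_0_iff by metis
  then show "s = t \<and> int n dvd z"
    by (metis add_eq_0_iff2 dvd_minus_iff dvd_triv_right)
next
  assume *: "s = t \<and> int n dvd z"
  then have "cyc_dist n s t z = cyc_dist n s t 0"
    by (intro cyc_dist_cong) simp
  also have "\<dots> \<le> cover_dist s t 0"
    using cyc_dist_le[of n s t 0 0] by simp
  finally show "cyc_dist n s t z = 0"
    using * cover_dist_eq_0_iff[of s t 0] by simp
qed

section \<open>Agreement with the graph distance\<close>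

fun vertex :: "bool \<Rightarrow> nat \<Rightarrow> petersen_vertex" where
  "vertex False j = U j" | "vertex True j = V j"

definition dist_from :: "nat \<Rightarrow> bool \<Rightarrow> nat \<Rightarrow> petersen_vertex \<Rightarrow> nat" where
  "dist_from n s p x = (case x of U j \<Rightarrow> cyc_dist n s False (int j - int p)
     | V j \<Rightarrow> cyc_dist n s True (int j - int p))"

lemma cyc_dist_mod: "cyc_dist n s t (int (m mod n) - p) = cyc_dist n s t (int m - p)"
  by (intro cyc_dist_cong) (simp add: zmod_int mod_eq_dvd_iff[symmetric])


lemma petersen_3_arc_iff:
  "(x, y) \<in> arcs (petersen n 3) \<longleftrightarrow> (x, y) \<in> petersen_arcs n 3 \<or> (y, x) \<in> petersen_arcs n 3"
  by (auto simp: petersen_def)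

text \<open>Both inequalities are needed because \<open>petersen_arcs\<close> holds only one
  orientation of each edge.\<close>

lemma dist_from_lipschitz:
  assumes "(x, y) \<in> petersen_arcs n 3"
  shows "dist_from n s p y \<le> dist_from n s p x + 1 \<and> dist_from n s p x \<le> dist_from n s p y + 1"
proof -
  let ?c = "\<lambda>t j. cyc_dist n s t (int j - int p)"
  have "?c False (j + 1) \<le> ?c False j + 1" "?c False j \<le> ?c False (j + 1) + 1" for j
    using cyc_dist_lipschitz[of s False 1 False n "int j - int p"]
      cyc_dist_lipschitz[of s False "-1" False n "int (j + 1) - int p"]
      cover_dist_add_1_le[of s] cover_dist_le_add_1[of s "_ - 1"]
    by (simp_all add: algebra_simps)
  moreover have "?c True (j + 3) \<le> ?c True j + 1" "?c True j \<le> ?c True (j + 3) + 1" for j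
    using cyc_dist_lipschitz[of s True 3 True n "int j - int p"]
      cyc_dist_lipschitz[of s True "-3" True n "int (j + 3) - int p"]
      cover_dist_add_3_le[of s] cover_dist_le_add_3[of s "_ - 3"]
    by (simp_all add: algebra_simps)
  moreover have "?c t j \<le> ?c (\<not> t) j + 1" for t j
    using cyc_dist_lipschitz[of s t 0 "\<not> t" n "int j - int p"] cover_dist_spoke[of s t] by simp
  from this[of True] this[of False] have "?c True j \<le> ?c False j + 1" "?c False j \<le> ?c True j + 1" for j
    by simp_all
  ultimately show ?thesis
    using assms unfolding petersen_arcs_def
    by (auto simp: dist_from_def cyc_dist_mod simp del: of_nat_add)
qed

text \<open>A descent at the lift that attains the minimum is a descent in the quotient, since any
  lift of the neighbour bounds its distance from above.\<close>

lemma cyc_dist_less: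
  assumes "cyc_dist n s t z = cover_dist s t (z + i * int n)"
    "cover_dist s t' (z + i * int n + d) < cover_dist s t (z + i * int n)"
  shows "cyc_dist n s t' (z + d) < cyc_dist n s t z"
  using assms cyc_dist_le[of n s t' "z + d" i] by (simp add: algebra_simps)

text \<open>The arcs are those entering a vertex, as the descent asks for predecessors. A step back
  by \<open>k\<close> is written as adding \<open>n - k\<close> to stay within the naturals.\<close>

lemma petersen_3_neighbours:
  assumes "j < n" "3 < n"
  shows "(U j, V j) \<in> arcs (petersen n 3)" "(V j, U j) \<in> arcs (petersen n 3)"
    "(U ((j + 1) mod n), U j) \<in> arcs (petersen n 3)" "(V ((j + 3) mod n), V j) \<in> arcs (petersen n 3)"
    "(U ((j + (n - 1)) mod n), U j) \<in> arcs (petersen n 3)"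
    "(V ((j + (n - 3)) mod n), V j) \<in> arcs (petersen n 3)"
proof -
  have *: "j = ((j + (n - k)) mod n + k) mod n" if "k \<le> n" for k
    using that assms(1) by (simp add: mod_add_left_eq)
  show "(U j, V j) \<in> arcs (petersen n 3)" "(V j, U j) \<in> arcs (petersen n 3)"
    "(U ((j + 1) mod n), U j) \<in> arcs (petersen n 3)" "(V ((j + 3) mod n), V j) \<in> arcs (petersen n 3)"
    using assms unfolding petersen_3_arc_iff petersen_arcs_def by auto
  show "(U ((j + (n - 1)) mod n), U j) \<in> arcs (petersen n 3)"
    using assms *[of 1] unfolding petersen_3_arc_iff petersen_arcs_def by auto
  show "(V ((j + (n - 3)) mod n), V j) \<in> arcs (petersen n 3)"
    using assms *[of 3] unfolding petersen_3_arc_iff petersen_arcs_def by auto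
qed

lemma dist_from_descent:
  assumes "3 < n" "y \<in> verts (petersen n 3)" "dist_from n s p y \<noteq> 0"
  obtains x where "(x, y) \<in> arcs (petersen n 3)" "dist_from n s p x < dist_from n s p y"
proof -
  have minus: "cyc_dist n s t (int (j + (n - k)) - int p) = cyc_dist n s t (int j - int p - int k)"
    if "k \<le> n" for t j k
    using that by (intro cyc_dist_cong) (simp add: of_nat_diff)
  show thesis
  proof (cases y)
    case (U j)
    then have "j < n" using assms(2) by (auto simp: petersen_def)
    note nb = petersen_3_neighbours[OF this assms(1)]
    obtain i where i: "cyc_dist n s False (int j - int p) = cover_dist s False (int j - int p + i * int n)"
      by (rule cyc_dist_attained)
    then have "cover_dist s False (int j - int p + i * int n) \<noteq> 0"
      using assms(3) U by (simp add: dist_from_def)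
    from cover_dist_descent_outer[OF this]
    consider "cyc_dist n s False (int j - int p + 1) < cyc_dist n s False (int j - int p)"
      | "cyc_dist n s False (int j - int p - 1) < cyc_dist n s False (int j - int p)"
      | "cyc_dist n s True (int j - int p) < cyc_dist n s False (int j - int p)"
      using cyc_dist_less[OF i, of False 1] cyc_dist_less[OF i, of False "-1"] cyc_dist_less[OF i, of True 0]
      by auto
    then show thesis
    proof cases
      case 1
      then show thesis
        using that[of "U ((j + 1) mod n)"] nb U cyc_dist_mod[of n s False "j + 1" p]
        by (simp add: dist_from_def algebra_simps)
    next
      case 2
      then show thesis
        using that[of "U ((j + (n - 1)) mod n)"] nb U minus[of 1 False j] cyc_dist_mod[of n s False "j + (n - 1)" p]
          assms(1)
        by (simp add: dist_from_def algebra_simps)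
    next
      case 3
      then show thesis using that[of "V j"] nb U by (simp add: dist_from_def)
    qed
  next
    case (V j)
    then have "j < n" using assms(2) by (auto simp: petersen_def)
    note nb = petersen_3_neighbours[OF this assms(1)]
    obtain i where i: "cyc_dist n s True (int j - int p) = cover_dist s True (int j - int p + i * int n)"
      by (rule cyc_dist_attained)
    then have "cover_dist s True (int j - int p + i * int n) \<noteq> 0"
      using assms(3) V by (simp add: dist_from_def)
    from cover_dist_descent_inner[OF this]
    consider "cyc_dist n s True (int j - int p + 3) < cyc_dist n s True (int j - int p)"
      | "cyc_dist n s True (int j - int p - 3) < cyc_dist n s True (int j - int p)"
      | "cyc_dist n s False (int j - int p) < cyc_dist n s True (int j - int p)"
      using cyc_dist_less[OF i, of True 3] cyc_dist_less[OF i, of True "-3"] cyc_dist_less[OF i, of False 0]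
      by auto
    then show thesis
    proof cases
      case 1
      then show thesis
        using that[of "V ((j + 3) mod n)"] nb V cyc_dist_mod[of n s True "j + 3" p]
        by (simp add: dist_from_def algebra_simps)
    next
      case 2
      then show thesis
        using that[of "V ((j + (n - 3)) mod n)"] nb V minus[of 3 True j] cyc_dist_mod[of n s True "j + (n - 3)" p]
          assms(1)
        by (simp add: dist_from_def algebra_simps)
    next
      case 3
      then show thesis using that[of "U j"] nb V by (simp add: dist_from_def)
    qed
  qed
qed

lemma graph_dist_petersen_3:
  assumes "6 < n" "p < n" "y \<in> verts (petersen n 3)"
  shows "graph_dist (petersen n 3) (vertex s p) y = dist_from n s p y"
proof (rule graph_dist_eqI)
  interpret graph "petersen n 3" using assms by (intro graph_petersen) auto
  show "wf_digraph (petersen n 3)" ..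
  show "vertex s p \<in> verts (petersen n 3)"
    using assms by (cases s) (auto simp: petersen_def)
  show "dist_from n s p (vertex s p) = 0"
    by (cases s) (simp_all add: dist_from_def cyc_dist_eq_0_iff)
  show "y = vertex s p" if "y \<in> verts (petersen n 3)" "dist_from n s p y = 0" for y
  proof -
    have "j = p" if "int n dvd int j - int p" "j < n" for j
      using that assms(2) by (metis mod_eq_dvd_iff mod_less of_nat_eq_iff zmod_int)
    then show ?thesis
      using that by (auto simp: petersen_def dist_from_def cyc_dist_eq_0_iff)
  qed
  show "dist_from n s p (head (petersen n 3) a) \<le> dist_from n s p (tail (petersen n 3) a) + 1"
    if "a \<in> arcs (petersen n 3)" for a
    using that dist_from_lipschitz[of "fst a" "snd a" n s p] dist_from_lipschitz[of "snd a" "fst a" n s p]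
    by (auto simp: petersen_def)
  show "\<exists>a\<in>arcs (petersen n 3). head (petersen n 3) a = y \<and> dist_from n s p (tail (petersen n 3) a) < dist_from n s p y"
    if "y \<in> verts (petersen n 3)" "dist_from n s p y \<noteq> 0" for y
  proof -
    from \<open>6 < n\<close> have "3 < n" by simp
    then obtain x where "(x, y) \<in> arcs (petersen n 3)" "dist_from n s p x < dist_from n s p y"
      using \<open>y \<in> _\<close> \<open>dist_from n s p y \<noteq> 0\<close> by (rule dist_from_descent)
    then show ?thesis by (intro bexI[of _ "(x, y)"]) (simp_all add: petersen_def)
  qed
qed fact

subsection \<open>Edge codes\<close>

datatype edge_kind = Outer | Inner | Spoke

fun edge :: "nat \<Rightarrow> edge_kind \<Rightarrow> nat \<Rightarrow> petersen_vertex set" where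
  "edge n Outer j = {U j, U ((j + 1) mod n)}"
| "edge n Inner j = {V j, V ((j + 3) mod n)}"
| "edge n Spoke j = {U j, V j}"

text \<open>The offset \<open>z\<close> belongs to the first end; the other end lies up to 3
  positions further. This causes the asymmetric bounds on positions below.\<close>

fun edge_dist :: "nat \<Rightarrow> bool \<Rightarrow> edge_kind \<Rightarrow> int \<Rightarrow> nat" where
  "edge_dist n s Outer z = min (cyc_dist n s False z) (cyc_dist n s False (z + 1))"
| "edge_dist n s Inner z = min (cyc_dist n s True z) (cyc_dist n s True (z + 3))"
| "edge_dist n s Spoke z = min (cyc_dist n s False z) (cyc_dist n s True z)"

lemma vertex_edge_dist_petersen_3:
  assumes "6 < n" "p < n" "j < n"
  shows "vertex_edge_dist (petersen n 3) (vertex s p) (edge n k j) = edge_dist n s k (int j - int p)"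
proof -
  have U: "graph_dist (petersen n 3) (vertex s p) (U i) = cyc_dist n s False (int i - int p)"
    and V: "graph_dist (petersen n 3) (vertex s p) (V i) = cyc_dist n s True (int i - int p)" if "i < n" for i
    using that graph_dist_petersen_3[OF assms(1,2)] by (auto simp: petersen_def dist_from_def)
  have shift: "cyc_dist n s t (int ((j + m) mod n) - int p) = cyc_dist n s t (int j - int p + int m)" for t m
    using cyc_dist_mod[of n s t "j + m" p] by (simp only: of_nat_add diff_add_eq)
  have 1: "cyc_dist n s t (int ((j + 1) mod n) - int p) = cyc_dist n s t (int j - int p + 1)" for t
    using shift[of t 1] by simp
  have 3: "cyc_dist n s t (int ((j + 3) mod n) - int p) = cyc_dist n s t (int j - int p + 3)" for t
    using shift[of t 3] by simp
  have min: "min (ereal (real a)) (ereal (real b)) = ereal (real (min a b))" for a b :: nat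
    by (simp add: min_def)
  have "(j + m) mod n < n" for m using assms by simp
  then show ?thesis
    using assms(3)
    by (cases k) (simp_all only: edge.simps edge_dist.simps vertex_edge_dist_doubleton U V 1 3 min)
qed

lemma uedges_petersen_3: "uedges (petersen n 3) = (\<Union>k. edge n k ` {..<n})"
proof -
  have kinds: "(UNIV :: edge_kind set) = {Outer, Inner, Spoke}"
    using edge_kind.exhaust by blast
  have image: "{f j | j. j < n} = f ` {..<n}" for f :: "nat \<Rightarrow> petersen_vertex set"
    by blast
  have "edge n Outer = (\<lambda>j. {U j, U ((j + 1) mod n)})" "edge n Inner = (\<lambda>j. {V j, V ((j + 3) mod n)})"
    "edge n Spoke = (\<lambda>j. {U j, V j})"
    by (simp_all add: fun_eq_iff)
  then show ?thesis
    unfolding uedges_petersen kinds image by (simp add: Un_assoc)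
qed

section \<open>Edge distances when \<open>n\<close> grows by 6\<close>

lemma edge_dist_cong: "int n dvd z - w \<Longrightarrow> edge_dist n s k z = edge_dist n s k w"
  using cyc_dist_cong[of n z w s] cyc_dist_cong[of n "z + 1" "w + 1" s] cyc_dist_cong[of n "z + 3" "w + 3" s]
  by (cases k) simp_all

text \<open>All ends have offsets between \<open>z\<close> and \<open>z + 3\<close>. The bounds make
  each so small that the direct lift is optimal for \<open>n\<close> and for
  \<open>n + 6\<close>.\<close>

lemma edge_dist_near:
  assumes "8 - int n \<le> 2 * z" "2 * z + 14 \<le> int n"
  shows "edge_dist (n + 6) s k z = edge_dist n s k z"
proof -
  have "cyc_dist (n + 6) s t w = cyc_dist n s t w" if "z \<le> w" "w \<le> z + 3" for t w
    using assms that by (simp add: cyc_dist_eq_cover_dist)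
  then show ?thesis by (cases k) simp_all
qed

lemma edge_dist_shift_right:
  assumes "3 \<le> z" "z + 6 \<le> int n"
  shows "edge_dist (n + 6) s k (z + 3) = edge_dist n s k z + 1"
proof -
  have "cyc_dist (n + 6) s t (w + 3) = cyc_dist n s t w + 1" if "z \<le> w" "w \<le> z + 3" for t w
    using assms that by (intro cyc_dist_shift) linarith+
  from this[of z] this[of "z + 1"] this[of "z + 3"] show ?thesis by (cases k) (simp_all add: algebra_simps)
qed

text \<open>Mirror image of \<open>edge_dist_shift_right\<close>. Here \<open>z + 3\<close> is the
  offset nearest to 0, so \<open>z \<le> -6\<close> is what keeps all ends at least 3 away.\<close>

lemma edge_dist_shift_left:
  assumes "z \<le> -6" "3 - int n \<le> z"
  shows "edge_dist (n + 6) s k (z - 3) = edge_dist n s k z + 1"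
proof -
  have "cyc_dist (n + 6) s t (w - 3) = cyc_dist n s t w + 1" if "z \<le> w" "w \<le> z + 3" for t w
    using assms that cyc_dist_shift[of n "- w" s t] cyc_dist_minus[of n s t w] cyc_dist_minus[of "n + 6" s t "w - 3"]
    by simp
  from this[of z] this[of "z + 1"] this[of "z + 3"] show ?thesis by (cases k) (simp_all add: algebra_simps)
qed

lemma cyc_dist_le_6D:
  assumes "8 \<le> n" "0 \<le> z" "z \<le> int n" "cyc_dist n False t z \<le> 6"
  shows "z \<le> 15 \<or> int n - 15 \<le> z"
proof -
  \<comment> \<open>The extreme case is an inner vertex reached by one spoke and five inner
    steps.\<close>
  have *: "\<bar>w\<bar> \<le> 15" if "cover_dist False t w \<le> 6" for w
    using that by (cases rule: cover_dist_cases[of w False t]) (auto split: if_splits)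
  then show ?thesis
    using assms *[of z] *[of "int n - z"] by (auto simp: cyc_dist_eq_min min_def split: if_splits)
qed

text \<open>Some end lies within 15 positions of 0. The first end of an inner edge may lie 3
  positions before it, so the left bound is -18.\<close>

lemma edge_dist_le_6E:
  assumes "48 \<le> n" "edge_dist n False k z \<le> 6"
  obtains r where "int n dvd z - r" "-18 \<le> r" "r \<le> 15"
proof -
  define m where "m = z mod int n"
  have m: "0 \<le> m" "m < int n" "int n dvd z - m"
    using assms(1) by (simp_all add: m_def)
  then have "edge_dist n False k m \<le> 6"
    using assms(2) edge_dist_cong by metis
  then obtain t w where w: "m \<le> w" "w \<le> m + 3" "cyc_dist n False t w \<le> 6"
    by (cases k) (auto simp: min_le_iff_disj intro: that[of m] that[of "m + 1"] that[of "m + 3"])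
  have "m \<le> 15 \<or> int n - 18 \<le> m"
    using cyc_dist_le_6D[of n w t] w m assms(1) by linarith
  then show thesis
  proof
    assume "m \<le> 15" then show thesis using that[of m] m by simp
  next
    assume "int n - 18 \<le> m"
    moreover have "int n dvd z - (m - int n)"
      using dvd_add[OF m(3) dvd_refl[of "int n"]] by (simp add: algebra_simps)
    ultimately show thesis using that[of "m - int n"] m by simp
  qed
qed

lemma edge_dist_gt_6E:
  assumes "48 \<le> n" "6 < edge_dist n False k z"
  obtains r where "int n dvd z - r" "8 \<le> r" "r \<le> int n - 13"
proof -
  \<comment> \<open>In this window only the outer vertex at -11 costs 7 in the infinite graph; the
    outer edge and the spoke at that position each have another end of cost 6.\<close>
  have le: "edge_dist n False k w \<le> 6" if "-12 \<le> w" "w \<le> 7" for w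
  proof -
    have "cover_dist False True w \<le> 6"
      using that by (cases rule: cover_dist_cases[of w False True]) (auto split: if_splits)
    moreover have "cover_dist False False w \<le> 6" if "w \<noteq> -11"
      using that \<open>-12 \<le> w\<close> \<open>w \<le> 7\<close>
      by (cases rule: cover_dist_cases[of w False False]; simp split: if_splits; arith)
    moreover have "cover_dist False False (-11 + 1) \<le> 6"
      by (simp add: cover_dist_def)
    ultimately have "cover_dist False True w \<le> 6" "cover_dist False False w \<le> 6 \<or> cover_dist False False (w + 1) \<le> 6"
      by blast+
    then show ?thesis
      using cyc_dist_le[of n False True w 0] cyc_dist_le[of n False False w 0]
        cyc_dist_le[of n False False "w + 1" 0]
      by (cases k) (auto simp: min_le_iff_disj)
  qed
  define m where "m = z mod int n"
  have m: "0 \<le> m" "m < int n" "int n dvd z - m"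
    using assms(1) by (simp_all add: m_def)
  \<comment> \<open>Reading the same edge at \<open>m\<close> and at \<open>m - int n\<close> gives
    the lower and the upper bound.\<close>
  then have "6 < edge_dist n False k m" "6 < edge_dist n False k (m - int n)"
    using assms(2) edge_dist_cong[of n z m] edge_dist_cong[of n "m - int n" m] by simp_all
  then show thesis
    using le[of m] le[of "m - int n"] m by (intro that[of m]) linarith+
qed

section \<open>Codes and the induction step\<close>

text \<open>The position \<open>z\<close> of an edge is any integer, to be read modulo \<open>n\<close>.\<close>

definition edge_code :: "nat \<Rightarrow> nat \<Rightarrow> edge_kind \<Rightarrow> int \<Rightarrow> nat \<times> nat \<times> nat \<times> nat" where
  "edge_code n p k z = (edge_dist n False k z, edge_dist n True k (z - 1), edge_dist n True k (z - 2),
     edge_dist n False k (z - int p))"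

definition codes_distinct :: "nat \<Rightarrow> nat \<Rightarrow> bool" where
  "codes_distinct n p \<longleftrightarrow>
     (\<forall>k k' z z'. edge_code n p k z = edge_code n p k' z' \<longrightarrow> k = k' \<and> int n dvd z - z')"

lemma edge_code_cong:
  assumes "int n dvd z - w"
  shows "edge_code n p k z = edge_code n p k w"
proof -
  have "int n dvd (z - d) - (w - d)" for d using assms by simp
  then show ?thesis
    using assms edge_dist_cong[of n z w] edge_dist_cong[of n "z - d" "w - d" for d] by (simp add: edge_code_def)
qed

text \<open>Equal codes agree in the first coordinate, so the threshold 6 sends both edges back to
  \<open>n\<close> by the same rule and their codes stay equal. The relation between
  \<open>n\<close> and \<open>p\<close> places \<open>U p\<close> almost opposite
  \<open>U 0\<close>.\<close>

lemma codes_distinct_add_6: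
  assumes "48 \<le> n" "n \<in> {2 * p + 4, 2 * p + 5}" "codes_distinct n p"
  shows "codes_distinct (n + 6) (p + 3)"
  unfolding codes_distinct_def
proof (intro allI impI)
  fix k k' z z'
  assume eq: "edge_code (n + 6) (p + 3) k z = edge_code (n + 6) (p + 3) k' z'"
  have p: "2 * int p + 4 \<le> int n" "int n \<le> 2 * int p + 5" "48 \<le> int n"
    using assms(1,2) by auto
  have n6: "48 \<le> n + 6" using assms(1) by simp
  have inj: "k = k' \<and> r = r'" if "edge_code n p k r = edge_code n p k' r'" "\<bar>r - r'\<bar> < int n" for r r'
  proof -
    have "k = k'" "int n dvd r - r'"
      using assms(3) that(1) unfolding codes_distinct_def by blast+
    then show ?thesis
      using dvd_imp_le_int[of "r - r'" "int n"] that(2) by fastforce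
  qed
  have concl: "k = k' \<and> int (n + 6) dvd z - z'" if "k = k'" "int (n + 6) dvd z - r" "int (n + 6) dvd z' - r" for r
    using that dvd_diff[OF that(2,3)] by simp
  show "k = k' \<and> int (n + 6) dvd z - z'"
  proof (cases "edge_dist (n + 6) False k z \<le> 6")
    case True
    then have "edge_dist (n + 6) False k' z' \<le> 6"
      using eq by (simp add: edge_code_def)
    with n6 obtain r' where r': "int (n + 6) dvd z' - r'" "-18 \<le> r'" "r' \<le> 15"
      by (rule edge_dist_le_6E)
    from n6 True obtain r where r: "int (n + 6) dvd z - r" "-18 \<le> r" "r \<le> 15"
      by (rule edge_dist_le_6E)
    \<comment> \<open>The bound 48 comes from here: seen from \<open>V 2\<close>, position -18 has
      offset -20, and \<open>edge_dist_near\<close> then requires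
      \<open>8 - int n \<le> -40\<close>.\<close>
    have shift: "edge_dist (n + 6) False k w = edge_dist n False k w"
      "edge_dist (n + 6) True k (w - 1) = edge_dist n True k (w - 1)"
      "edge_dist (n + 6) True k (w - 2) = edge_dist n True k (w - 2)"
      "edge_dist (n + 6) False k (w - int (p + 3)) = edge_dist n False k (w - int p) + 1"
      if "-18 \<le> w" "w \<le> 15" for k w
      using that p edge_dist_near[of n w False k] edge_dist_near[of n "w - 1" True k]
        edge_dist_near[of n "w - 2" True k] edge_dist_shift_left[of "w - int p" n False k]
      by (simp_all add: algebra_simps)
    have "edge_code (n + 6) (p + 3) k r = edge_code (n + 6) (p + 3) k' r'"
      using eq edge_code_cong[OF r(1), of "p + 3" k] edge_code_cong[OF r'(1), of "p + 3" k'] by metis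
    then have "edge_code n p k r = edge_code n p k' r'"
      unfolding edge_code_def shift[OF r(2,3)] shift[OF r'(2,3)] by simp
    moreover have "\<bar>r - r'\<bar> < int n"
      using r r' p by linarith
    ultimately have "k = k' \<and> r = r'"
      by (rule inj)
    then have "k = k'" "r = r'"
      by simp_all
    from \<open>k = k'\<close> r(1) r'(1)[folded \<open>r = r'\<close>] show ?thesis
      by (rule concl)
  next
    case False
    then have gt: "6 < edge_dist (n + 6) False k z" "6 < edge_dist (n + 6) False k' z'"
      using eq by (simp_all add: edge_code_def)
    from n6 gt(1) obtain r where r: "int (n + 6) dvd z - r" "8 \<le> r" "r \<le> int (n + 6) - 13"
      by (rule edge_dist_gt_6E)
    from n6 gt(2) obtain r' where r': "int (n + 6) dvd z' - r'" "8 \<le> r'" "r' \<le> int (n + 6) - 13"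
      by (rule edge_dist_gt_6E)
    \<comment> \<open>The lower bound 8 is what \<open>V 2\<close> demands, as
      \<open>w - 3 - 2\<close> must be at least 3. The upper bound, with
      \<open>n \<le> 2 * p + 5\<close>, keeps the offset from \<open>p\<close> within reach of
      \<open>edge_dist_near\<close>.\<close>
    have shift: "edge_dist (n + 6) False k w = edge_dist n False k (w - 3) + 1"
      "edge_dist (n + 6) True k (w - 1) = edge_dist n True k (w - 3 - 1) + 1"
      "edge_dist (n + 6) True k (w - 2) = edge_dist n True k (w - 3 - 2) + 1"
      "edge_dist (n + 6) False k (w - int (p + 3)) = edge_dist n False k (w - 3 - int p)"
      if "8 \<le> w" "w \<le> int (n + 6) - 13" for k w
    proof -
      from that have w: "8 \<le> w" "w \<le> int n - 7" by simp_all
      show "edge_dist (n + 6) False k w = edge_dist n False k (w - 3) + 1"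
        using w edge_dist_shift_right[of "w - 3" n False k] by simp
      show "edge_dist (n + 6) True k (w - 1) = edge_dist n True k (w - 3 - 1) + 1"
        using w edge_dist_shift_right[of "w - 3 - 1" n True k] by simp
      show "edge_dist (n + 6) True k (w - 2) = edge_dist n True k (w - 3 - 2) + 1"
        using w edge_dist_shift_right[of "w - 3 - 2" n True k] by simp
      have "edge_dist (n + 6) False k (w - 3 - int p) = edge_dist n False k (w - 3 - int p)"
        using w p edge_dist_near[of n "w - 3 - int p" False k] by simp
      moreover have "w - int (p + 3) = w - 3 - int p" by simp
      ultimately show "edge_dist (n + 6) False k (w - int (p + 3)) = edge_dist n False k (w - 3 - int p)"
        by (simp only:)
    qed
    have "edge_code (n + 6) (p + 3) k r = edge_code (n + 6) (p + 3) k' r'"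
      using eq edge_code_cong[OF r(1), of "p + 3" k] edge_code_cong[OF r'(1), of "p + 3" k'] by metis
    then have "edge_code n p k (r - 3) = edge_code n p k' (r' - 3)"
      unfolding edge_code_def shift[OF r(2,3)] shift[OF r'(2,3)] by simp
    moreover have "\<bar>(r - 3) - (r' - 3)\<bar> < int n"
      using r r' p by linarith
    ultimately have "k = k' \<and> r - 3 = r' - 3"
      by (rule inj)
    then have "k = k'" "r = r'"
      by simp_all
    from \<open>k = k'\<close> r(1) r'(1)[folded \<open>r = r'\<close>] show ?thesis
      by (rule concl)
  qed
qed

section \<open>From distinct codes to a resolving set\<close>

text \<open>The code of an edge lists its distances from the four vertices, so an unresolved pair
  would have equal codes, hence equal kinds and equal residues.\<close>

lemma edge_resolving_set_if_codes_distinct: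
  assumes "11 \<le> n" "p < n" "codes_distinct n p"
  shows "edge_resolving_set (petersen n 3) {U 0, V 1, V 2, U p}"
  unfolding edge_resolving_set_def
proof (intro conjI ballI impI)
  show "{U 0, V 1, V 2, U p} \<subseteq> verts (petersen n 3)"
    using assms(1,2) by (auto simp: petersen_def)
next
  fix e e'
  assume "e \<in> uedges (petersen n 3)" "e' \<in> uedges (petersen n 3)" "e \<noteq> e'"
  then obtain k j k' j' where e: "e = edge n k j" "j < n" "e' = edge n k' j'" "j' < n"
    unfolding uedges_petersen_3 by auto
  show "\<exists>x\<in>{U 0, V 1, V 2, U p}. vertex_edge_dist (petersen n 3) x e \<noteq> vertex_edge_dist (petersen n 3) x e'"
  proof (rule ccontr)
    assume *: "\<not> ?thesis"
    have "edge_dist n s k (int j - int q) = edge_dist n s k' (int j' - int q)"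
      if "vertex s q \<in> {U 0, V 1, V 2, U p}" "q < n" for s q
      using * that e assms(1) vertex_edge_dist_petersen_3[of n q j s k] vertex_edge_dist_petersen_3[of n q j' s k']
      by auto
    from this[of False 0] this[of True 1] this[of True 2] this[of False p]
    have "edge_code n p k j = edge_code n p k' j'"
      using assms(1,2) by (simp add: edge_code_def)
    then have "k = k'" "int n dvd int j - int j'"
      using assms(3) unfolding codes_distinct_def by blast+
    then have "j = j'"
      using e by (metis mod_eq_dvd_iff mod_less of_nat_eq_iff zmod_int)
    then show False using e \<open>k = k'\<close> \<open>e \<noteq> e'\<close> by simp
  qed
qed

subsection \<open>Evaluation of the codes for small \<open>n\<close>\<close>

text \<open>The state is the next three values of a sequence that grows by 1 every three places, so
  evaluation uses only \<open>Suc\<close>.\<close>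

fun ramp :: "nat \<Rightarrow> nat \<Rightarrow> nat \<Rightarrow> nat \<Rightarrow> nat list" where
  "ramp 0 a b c = []"
| "ramp (Suc m) a b c = a # ramp m b c (Suc a)"

lemma map_upt_eq_ramp:
  assumes "\<And>i. f (i + 3) = Suc (f i)"
  shows "map f [0..<m] = ramp m (f 0) (f 1) (f 2)"
  using assms
proof (induction m arbitrary: f)
  case (Suc m)
  have "map f [0..<Suc m] = f 0 # map (\<lambda>i. f (Suc i)) [0..<m]"
    by (simp add: upt_conv_Cons map_Suc_upt[symmetric] del: upt_Suc)
  also have "\<dots> = f 0 # ramp m (f 1) (f 2) (f 3)"
    using Suc.IH[of "\<lambda>i. f (Suc i)"] Suc.prems by (simp add: numeral_2_eq_2 numeral_3_eq_3)
  finally show ?case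
    using Suc.prems[of 0] by simp
qed simp

definition rot :: "nat \<Rightarrow> 'a list \<Rightarrow> 'a list" where
  "rot m xs = drop m xs @ take m xs"

lemma rot_map_upt:
  assumes "m \<le> n" "\<And>i. f (i + n) = f i"
  shows "rot m (map f [0..<n]) = map (\<lambda>i. f (i + m)) [0..<n]"
proof (rule nth_equalityI)
  fix i assume "i < length (rot m (map f [0..<n]))"
  then have "i < n" using assms(1) by (simp add: rot_def)
  then show "rot m (map f [0..<n]) ! i = map (\<lambda>i. f (i + m)) [0..<n] ! i"
    using assms(1) assms(2)[of "i + m - n"] by (auto simp: rot_def nth_append add.commute)
qed (use assms(1) in \<open>simp add: rot_def\<close>)

text \<open>
  The rows below tabulate distances without \<open>div\<close> and \<open>mod\<close>, which are slow under \<open>code_simp\<close>.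
\<close>

definition cover_row :: "nat \<Rightarrow> bool \<Rightarrow> bool \<Rightarrow> nat list" where
  "cover_row m s t = (if s \<and> t then ramp m 0 3 4 else if s \<or> t then ramp m 1 2 3
     else [0, 1, 2] @ ramp (m - 3) 3 4 5)"

lemma cover_row_eq:
  assumes "3 \<le> m"
  shows "cover_row m s t = map (\<lambda>i. cover_dist s t (int i)) [0..<m]"
proof (cases "s \<or> t")
  case True
  then have "cover_dist s t (int i + 3) = Suc (cover_dist s t (int i))" for i
    using cover_dist_shift[of "int i" s t] by auto
  then have "map (\<lambda>i. cover_dist s t (int i)) [0..<m]
      = ramp m (cover_dist s t 0) (cover_dist s t 1) (cover_dist s t 2)"
    using map_upt_eq_ramp[of "\<lambda>i. cover_dist s t (int i)" m] by simp
  also have "\<dots> = cover_row m s t"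
    using True by (auto simp: cover_row_def cover_dist_def)
  finally show ?thesis ..
next
  case False
  have "[0..<m] = [0, 1, 2] @ map (\<lambda>i. i + 3) [0..<m - 3]"
    using assms upt_add_eq_append[of 0 3 "m - 3"] map_add_upt[of 3 "m - 3"] by (simp add: upt_rec)
  then have "map (\<lambda>i. cover_dist s t (int i)) [0..<m] = map (\<lambda>i. cover_dist s t (int i)) [0, 1, 2]
      @ map (\<lambda>i. cover_dist s t (int i + 3)) [0..<m - 3]"
    by (simp add: comp_def)
  also have "map (\<lambda>i. cover_dist s t (int i + 3)) [0..<m - 3]
      = ramp (m - 3) (cover_dist s t 3) (cover_dist s t 4) (cover_dist s t 5)"
    using map_upt_eq_ramp[of "\<lambda>i. cover_dist s t (int i + 3)" "m - 3"] cover_dist_shift[of "int _ + 3" s t]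
    by simp
  also have "map (\<lambda>i. cover_dist s t (int i)) [0, 1, 2] @ \<dots> = cover_row m s t"
    using False by (simp add: cover_row_def cover_dist_def)
  finally show ?thesis ..
qed

text \<open>With \<open>n + 1\<close> entries in the row, its reversed tail holds the value for
  \<open>n - i\<close> at place \<open>i\<close>; these are the two terms of
  \<open>cyc_dist_eq_min\<close>.\<close>

definition cyc_row :: "nat \<Rightarrow> bool \<Rightarrow> bool \<Rightarrow> nat list" where
  "cyc_row n s t = (let xs = cover_row (Suc n) s t in map2 min (butlast xs) (rev (tl xs)))"

lemma cyc_row_eq:
  assumes "8 \<le> n"
  shows "cyc_row n s t = map (\<lambda>i. cyc_dist n s t (int i)) [0..<n]"
proof (rule nth_equalityI)
  fix i assume "i < length (cyc_row n s t)"
  then have "i < n" using assms by (simp add: cyc_row_def cover_row_eq Let_def)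
  then show "cyc_row n s t ! i = map (\<lambda>i. cyc_dist n s t (int i)) [0..<n] ! i"
    using assms
    by (simp add: cyc_row_def cover_row_eq Let_def cyc_dist_eq_min rev_nth nth_butlast nth_tl of_nat_diff
        del: upt_Suc)
qed (use assms in \<open>simp add: cyc_row_def cover_row_eq Let_def\<close>)

text \<open>In \<open>codes\<close>, \<open>us\<close> and \<open>vs\<close> are distances from
  \<open>U 0\<close> and \<open>V 0\<close> to the edges of one kind; rotating by
  \<open>n - q\<close> moves the source to position \<open>q\<close>. The row \<open>uv\<close>
  serves both mixed directions by \<open>cyc_dist_commute\<close>.\<close>

definition code_rows :: "nat \<Rightarrow> nat \<Rightarrow> (nat \<times> nat \<times> nat \<times> nat) list" where
  "code_rows n p = (let
     uu = cyc_row n False False; uv = cyc_row n False True; vv = cyc_row n True True;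
     codes = (\<lambda>us vs. zip us (zip (rot (n - 1) vs) (zip (rot (n - 2) vs) (rot (n - p) us))))
   in codes (map2 min uu (rot 1 uu)) (map2 min uv (rot 1 uv))
    @ codes (map2 min uv (rot 3 uv)) (map2 min vv (rot 3 vv))
    @ codes (map2 min uu uv) (map2 min uv vv))"

lemma cyc_dist_commute: "cyc_dist n s t z = cyc_dist n t s z"
proof -
  have "cover_dist s t = cover_dist t s"
    by (cases s; cases t; simp add: cover_dist_def fun_eq_iff)
  then show ?thesis by (simp add: cyc_dist_def)
qed

lemma code_rows_eq:
  assumes "8 \<le> n" "p \<le> n"
  shows "code_rows n p = concat (map (\<lambda>k. map (\<lambda>i. edge_code n p k (int i)) [0..<n]) [Outer, Inner, Spoke])"
proof -
  have per: "edge_dist n s k (int (i + n)) = edge_dist n s k (int i)" for s k i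
    by (rule edge_dist_cong) simp
  have rot_cyc: "rot m (map (\<lambda>i. cyc_dist n s t (int i)) [0..<n]) = map (\<lambda>i. cyc_dist n s t (int i + int m)) [0..<n]" if "m \<le> n" for m s t
    using that assms rot_map_upt[of m n "\<lambda>i. cyc_dist n s t (int i)"] cyc_dist_cong[of n "int _ + int n" "int _" s t]
    by (simp add: cyc_row_eq)
  have zip_map: "map2 min (map f [0..<n]) (map g [0..<n]) = map (\<lambda>i. min (f i) (g i)) [0..<n]" for f g :: "nat \<Rightarrow> nat"
    by (simp add: zip_map_map zip_same_conv_map)
  have rows: "map2 min (cyc_row n s False) (rot 1 (cyc_row n s False)) = map (\<lambda>i. edge_dist n s Outer (int i)) [0..<n]"
    "map2 min (cyc_row n s True) (rot 3 (cyc_row n s True)) = map (\<lambda>i. edge_dist n s Inner (int i)) [0..<n]"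
    "map2 min (cyc_row n s False) (cyc_row n s True) = map (\<lambda>i. edge_dist n s Spoke (int i)) [0..<n]" for s
    using assms by (simp_all add: rot_cyc cyc_row_eq zip_map del: One_nat_def) 
  have comm: "cyc_row n True False = cyc_row n False True"
    using assms(1) cyc_dist_commute[of n True False] by (simp add: cyc_row_eq)
  have rot_edge: "rot (n - m) (map (\<lambda>i. edge_dist n s k (int i)) [0..<n]) = map (\<lambda>i. edge_dist n s k (int i - int m)) [0..<n]"
    if "m \<le> n" for m s k
  proof -
    have "edge_dist n s k (int (i + (n - m))) = edge_dist n s k (int i - int m)" for i
      using that by (intro edge_dist_cong) (simp add: of_nat_diff)
    then show ?thesis
      using rot_map_upt[of "n - m" n "\<lambda>i. edge_dist n s k (int i)"] per by simp
  qed
  have "zip us (zip (rot (n - 1) vs) (zip (rot (n - 2) vs) (rot (n - p) us))) = map (\<lambda>i. edge_code n p k (int i)) [0..<n]"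
    if "us = map (\<lambda>i. edge_dist n False k (int i)) [0..<n]" "vs = map (\<lambda>i. edge_dist n True k (int i)) [0..<n]" for us vs k
    using that assms rot_edge[of 1] rot_edge[of 2] rot_edge[of p] by (simp add: edge_code_def zip_map_map zip_same_conv_map comp_def)
  note * = this[OF rows(1)[of False] rows(1)[of True]] this[OF rows(2)[of False] rows(2)[of True]]
    this[OF rows(3)[of False] rows(3)[of True]]
  show ?thesis
    using * by (simp add: code_rows_def Let_def comm)
qed

text \<open>Splitting by the first component first avoids most of the quadratically many comparisons of \<^const>\<open>distinct\<close>.\<close>

definition distinct_buckets :: "nat \<Rightarrow> (nat \<times> 'a) list \<Rightarrow> bool" where
  "distinct_buckets m xs \<longleftrightarrow> list_all (\<lambda>x. fst x < m) xs \<and>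
     (\<forall>d\<in>set [0..<m]. distinct (map snd (filter (\<lambda>x. fst x = d) xs)))"

text \<open>Equal entries would share a bucket and have equal second components there. Buckets from
  \<open>m\<close> on are empty, so the finite check covers all of them.\<close>

lemma distinct_if_distinct_buckets:
  assumes "distinct_buckets m xs"
  shows "distinct xs"
proof -
  have "distinct (map snd (filter (\<lambda>x. fst x = d) xs))" for d
  proof (cases "d < m")
    case False
    then have "filter (\<lambda>x. fst x = d) xs = []"
      using assms by (auto simp: distinct_buckets_def list_all_iff filter_empty_conv)
    then show ?thesis by simp
  qed (use assms in \<open>simp add: distinct_buckets_def\<close>)
  then show ?thesis
  proof (induction xs)
    case (Cons x xs)
    have "x \<notin> set xs"
      using Cons.prems[of "fst x"] by force
    moreover have "distinct (map snd (filter (\<lambda>x. fst x = d) xs))" for d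
      using Cons.prems[of d] by (auto split: if_splits)
    ultimately show ?case using Cons.IH by simp
  qed simp
qed

text \<open>Integer positions reduce to residues below \<open>n\<close>. Distinctness of the
  concatenated list gives injectivity within a kind and disjointness between kinds.\<close>

lemma codes_distinct_if_distinct_buckets:
  assumes "distinct_buckets m (code_rows n p)" "8 \<le> n" "p \<le> n"
  shows "codes_distinct n p"
  unfolding codes_distinct_def
proof (intro allI impI)
  fix k k' z z'
  assume eq: "edge_code n p k z = edge_code n p k' z'"
  define i i' where "i = nat (z mod int n)" and "i' = nat (z' mod int n)"
  have i: "i < n" "i' < n" "int n dvd z - int i" "int n dvd z' - int i'"
    using assms(2) by (simp_all add: i_def i'_def nat_less_iff)
  have "distinct (code_rows n p)"
    using assms(1) by (rule distinct_if_distinct_buckets)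
  then have inj: "inj_on (\<lambda>i. edge_code n p k (int i)) {0..<n}"
    and disj: "k \<noteq> k' \<Longrightarrow> (\<lambda>i. edge_code n p k (int i)) ` {0..<n} \<inter> (\<lambda>i. edge_code n p k' (int i)) ` {0..<n} = {}"
    for k k'
    using assms(2,3) by (cases k; cases k'; auto simp: code_rows_eq distinct_map)+
  have eq': "edge_code n p k (int i) = edge_code n p k' (int i')"
    using eq edge_code_cong[OF i(3)] edge_code_cong[OF i(4)] by metis
  have "k = k'"
  proof (rule ccontr)
    assume "k \<noteq> k'"
    then have "(\<lambda>i. edge_code n p k (int i)) ` {0..<n} \<inter> (\<lambda>i. edge_code n p k' (int i)) ` {0..<n} = {}"
      by (rule disj)
    moreover have "edge_code n p k (int i) \<in> (\<lambda>i. edge_code n p k (int i)) ` {0..<n}"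
      "edge_code n p k' (int i') \<in> (\<lambda>i. edge_code n p k' (int i)) ` {0..<n}"
      using i by auto
    ultimately show False using eq' by auto
  qed
  with eq' have "i = i'"
    using inj_onD[OF inj] i by auto
  then show "k = k' \<and> int n dvd z - z'"
    using \<open>k = k'\<close> dvd_diff[OF i(3,4)] by simp
qed

section \<open>The fourth vertex and the conclusion\<close>

text \<open>The general value satisfies \<open>n = 2p + 4\<close> or \<open>n = 2p + 5\<close> and
  grows by 3 when \<open>n\<close> grows by 6. The exception 14 lies below the range of the
  induction step.\<close>

definition landmark :: "nat \<Rightarrow> nat" where
  "landmark n = (if n = 14 then 11 else n div 2 - 2)"

text \<open>One evaluation per \<open>n\<close>; for all \<open>n\<close> treated, no distance from
  \<open>U 0\<close> to an edge reaches 14. The later batches are shorter since the tables grow with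
  \<open>n\<close>.\<close>

lemma distinct_buckets_lt_31: "\<forall>n\<in>set [11..<31]. distinct_buckets 14 (code_rows n (landmark n))"
  by (simp del: set_upt, intro conjI; code_simp)

lemma distinct_buckets_lt_39: "\<forall>n\<in>set [31..<39]. distinct_buckets 14 (code_rows n (landmark n))"
  by (simp del: set_upt, intro conjI; code_simp)

lemma distinct_buckets_lt_45: "\<forall>n\<in>set [39..<45]. distinct_buckets 14 (code_rows n (landmark n))"
  by (simp del: set_upt, intro conjI; code_simp)

lemma distinct_buckets_lt_50: "\<forall>n\<in>set [45..<50]. distinct_buckets 14 (code_rows n (landmark n))"
  by (simp del: set_upt, intro conjI; code_simp)

lemma distinct_buckets_lt_54: "\<forall>n\<in>set [50..<54]. distinct_buckets 14 (code_rows n (landmark n))"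
  by (simp del: set_upt, intro conjI; code_simp)

text \<open>The evaluated range contains 48 to 53, one value for each residue modulo 6, so steps of
  6 from there reach every larger \<open>n\<close>.\<close>

lemma codes_distinct_landmark:
  assumes "11 \<le> n"
  shows "codes_distinct n (landmark n)"
  using assms
proof (induction n rule: less_induct)
  case (less n)
  show ?case
  proof (cases "n < 54")
    case True
    then have "n \<in> set [11..<31] \<union> set [31..<39] \<union> set [39..<45] \<union> set [45..<50] \<union> set [50..<54]"
      using less.prems unfolding Un_iff set_upt atLeastLessThan_iff by linarith
    then have "distinct_buckets 14 (code_rows n (landmark n))"
      using distinct_buckets_lt_31 distinct_buckets_lt_39 distinct_buckets_lt_45
        distinct_buckets_lt_50 distinct_buckets_lt_54 by blast
    then show ?thesis
      by (rule codes_distinct_if_distinct_buckets) (use less.prems in \<open>auto simp: landmark_def\<close>)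
  next
    case False
    define m where "m = n - 6"
    have m: "48 \<le> m" "m < n" "n = m + 6"
      using False by (simp_all add: m_def)
    then have "codes_distinct (m + 6) (landmark m + 3)"
      by (intro codes_distinct_add_6 less.IH) (auto simp: landmark_def)
    moreover have "landmark n = landmark m + 3"
      using m by (simp add: landmark_def)
    ultimately show ?thesis
      using m by simp
  qed
qed

theorem proposition2p3:
  fixes n :: nat
  assumes "n \<ge> 11"
  shows "\<exists>R. edge_resolving_set (petersen n 3) R \<and> card R = 4"
proof (intro exI conjI)
  show "edge_resolving_set (petersen n 3) {U 0, V 1, V 2, U (landmark n)}"
    using assms by (intro edge_resolving_set_if_codes_distinct codes_distinct_landmark)
      (auto simp: landmark_def)
  \<comment> \<open>For \<open>n \<ge> 11\<close> the landmark is at least 3, so the two outer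
    vertices differ.\<close>
  show "card {U 0, V 1, V 2, U (landmark n)} = 4"
    using assms by (simp add: landmark_def)
qed

end
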